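(* Let $f,g:\mathbb{R}^n\to\overline{\mathbb{R}}$ be proper, lower semicontinuous, and prox-bounded functions. If $f$ and $g$ are both variationally convex at $\bar x\in\operatorname{dom} f\cap\operatorname{dom} g$ for $\bar v\in\partial f(\bar x)\cap\partial g(\bar x)$, then, for all sufficiently small $\lambda>0$ and every $0\le\alpha\le1$, the proximal average $\varphi_\lambda^\alpha(f,g)$ is variationally convex at $\bar x$ for $\bar v$.
   Context: $\overline{\mathbb{R}}=[-\infty,+\infty]$; $f$ is proper if $f>-\infty$ and $f\not\equiv+\infty$; $\operatorname{dom} f=\{x: f(x)<+\infty\}$. Moreau envelope: $e_\lambda f(x)=\inf_{w}\{f(w)+\frac1{2\lambda}\|w-x\|^2\}$, $\lambda>0$. $f$ is prox-bounded if there exists $\lambda>0$ such that $e_\lambda f(x)>-\infty$ for some $x\in\mathbb{R}^n$; the supremum of all such $\lambda$ is the threshold $\lambda_f$. Proximal average: for proper, lsc, prox-bounded $f,g$ with thresholds $\lambda_f,\lambda_g$, for $0<\lambda<\min(\lambda_f,\lambda_g)$ and $0\le\alpha\le1$, $\varphi_\lambda^\alpha(f,g)=-e_\lambda\left(-\alpha e_\lambda f-(1-\alpha)e_\lambda g\right)$. Limiting subdifferential: for $\bar x\in\operatorname{dom}f$, the regular subdifferential is $\widehat\partial f(\bar x)=\{v:\liminf_{x\to\bar x,\,x\ne\bar x}\frac{f(x)-f(\bar x)-\langle v,x-\bar x\rangle}{\|x-\bar x\|}\ge0\}$, and $\partial f(\bar x)$ is the set of limits $v=\lim v_k$ with $v_k\in\widehat\partial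 f(x_k)$, $x_k\to\bar x$, $f(x_k)\to f(\bar x)$; $\partial f(x)=\emptyset$ for $x\notin\operatorname{dom}f$. $\operatorname{gph}\partial f=\{(x,v): v\in\partial f(x)\}$. Variational convexity: a proper lsc $f$ is variationally convex at $\bar x\in\operatorname{dom}f$ for $\bar v\in\partial f(\bar x)$ (the membership $\bar v\in\partial f(\bar x)$ being part of the property) if there exist open convex neighborhoods $U$ of $\bar x$ and $V$ of $\bar v$, a convex lsc function $\hat f:\mathbb{R}^n\to\overline{\mathbb{R}}$ with $\hat f\le f$ on $U$, and $\varepsilon>0$ such that $[U_\varepsilon\times V]\cap\operatorname{gph}\partial f=[U\times V]\cap\operatorname{gph}\partial\hat f$, where $U_\varepsilon=\{x\in U: f(x)<f(\bar x)+\varepsilon\}$, and moreover $f(x)=\hat f(x)$ for every $(x,v)$ in this common graph. *)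

theory Defs
  imports "HOL-Analysis.Analysis"
begin

section \<open>Extended-real-valued functions\<close>

definition effdom :: "('a \<Rightarrow> ereal) \<Rightarrow> 'a set" where
  "effdom f = {x. f x < \<infinity>}"

definition proper_fun :: "('a \<Rightarrow> ereal) \<Rightarrow> bool" where
  "proper_fun f \<longleftrightarrow> (\<forall>x. f x > -\<infinity>) \<and> (\<exists>x. f x \<noteq> \<infinity>)"

definition lsc_fun :: "('a::topological_space \<Rightarrow> ereal) \<Rightarrow> bool" where
  "lsc_fun f \<longleftrightarrow> (\<forall>x. f x \<le> Liminf (at x) f)"

text \<open>Convexity is convexity of the epigraph in \<open>\<real>\<^sup>n \<times> \<real>\<close>; this needs no convention for
  \<open>\<infinity> - \<infinity>\<close>, and functions taking the value \<open>-\<infinity>\<close> are allowed. The library's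
  \<open>convex_on\<close> and \<open>epigraph\<close> cover only real-valued functions.\<close>

definition convex_fun :: "('a::real_vector \<Rightarrow> ereal) \<Rightarrow> bool" where
  "convex_fun f \<longleftrightarrow> convex {(x, t::real). f x \<le> ereal t}"


section \<open>Moreau envelopes and proximal averages\<close>

definition moreau_env :: "real \<Rightarrow> ('a::real_normed_vector \<Rightarrow> ereal) \<Rightarrow> 'a \<Rightarrow> ereal" where
  "moreau_env lam f x = (INF w. f w + ereal (1 / (2 * lam) * (norm (w - x))\<^sup>2))"

definition prox_bounded :: "('a::real_normed_vector \<Rightarrow> ereal) \<Rightarrow> bool" where
  "prox_bounded f \<longleftrightarrow> (\<exists>lam>0. \<exists>x. moreau_env lam f x > -\<infinity>)"

definition prox_threshold :: "('a::real_normed_vector \<Rightarrow> ereal) \<Rightarrow> ereal" where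
  "prox_threshold f = (SUP lam\<in>{lam. lam > 0 \<and> (\<exists>x. moreau_env lam f x > -\<infinity>)}. ereal lam)"

text \<open>Meaningful for \<open>0 < lam < min (prox_threshold f) (prox_threshold g)\<close> and
  \<open>0 \<le> \<alpha> \<le> 1\<close>; for such \<open>lam\<close> the two inner envelopes are finite everywhere when
  \<open>f\<close> and \<open>g\<close> are proper, lower semicontinuous and prox-bounded.\<close>

definition prox_average ::
  "real \<Rightarrow> real \<Rightarrow> ('a::real_normed_vector \<Rightarrow> ereal) \<Rightarrow> ('a \<Rightarrow> ereal) \<Rightarrow> 'a \<Rightarrow> ereal" where
  "prox_average lam \<alpha> f g x =
     - moreau_env lam
         (\<lambda>w. - (ereal \<alpha> * moreau_env lam f w) - ereal (1 - \<alpha>) * moreau_env lam g w) x"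


section \<open>Subdifferentials\<close>

definition regular_subdiff :: "('a::real_inner \<Rightarrow> ereal) \<Rightarrow> 'a \<Rightarrow> 'a set" where
  "regular_subdiff f x =
     (if x \<in> effdom f
      then {v. Liminf (at x) (\<lambda>y. (f y - f x - ereal (v \<bullet> (y - x))) / ereal (norm (y - x))) \<ge> 0}
      else {})"

definition limiting_subdiff :: "('a::real_inner \<Rightarrow> ereal) \<Rightarrow> 'a \<Rightarrow> 'a set" where
  "limiting_subdiff f x =
     (if x \<in> effdom f
      then {v. \<exists>xs vs. (\<forall>k. vs k \<in> regular_subdiff f (xs k)) \<and>
                 xs \<longlonglongrightarrow> x \<and> (\<lambda>k. f (xs k)) \<longlonglongrightarrow> f x \<and> vs \<longlonglongrightarrow> v}
      else {})"

definition subdiff_graph :: "('a::real_inner \<Rightarrow> ereal) \<Rightarrow> ('a \<times> 'a) set" where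
  "subdiff_graph f = {(x, v). v \<in> limiting_subdiff f x}"


section \<open>Variational convexity\<close>

text \<open>The function \<open>h\<close> is not required to be proper. However, \<open>(xbar, vbar)\<close> lies in
  the common graph, so \<open>h xbar = f xbar\<close> is finite, and a convex lower semicontinuous
  function that is finite somewhere never takes the value \<open>-\<infinity>\<close>; hence the values of
  \<open>regular_subdiff\<close> at points where the function is \<open>-\<infinity>\<close> play no role.\<close>

definition variationally_convex :: "('a::euclidean_space \<Rightarrow> ereal) \<Rightarrow> 'a \<Rightarrow> 'a \<Rightarrow> bool" where
  "variationally_convex f xbar vbar \<longleftrightarrow>
     proper_fun f \<and> lsc_fun f \<and> xbar \<in> effdom f \<and> vbar \<in> limiting_subdiff f xbar \<and>
     (\<exists>U V h. \<exists>\<epsilon>>0.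
        open U \<and> convex U \<and> xbar \<in> U \<and> open V \<and> convex V \<and> vbar \<in> V \<and>
        convex_fun h \<and> lsc_fun h \<and> (\<forall>x\<in>U. h x \<le> f x) \<and>
        ({x \<in> U. f x < f xbar + ereal \<epsilon>} \<times> V) \<inter> subdiff_graph f = (U \<times> V) \<inter> subdiff_graph h \<and>
        (\<forall>(x, v) \<in> (U \<times> V) \<inter> subdiff_graph h. f x = h x))"

end

theory Submission
  imports Defs
begin

text \<open>Put \<open>zbar = xbar + lam *\<^sub>R vbar\<close>. A convex model of \<open>f\<close> and a quadratic minorant show that for
  small \<open>lam\<close> the proximal points \<open>p z\<close> of \<open>f\<close> are close to \<open>xbar\<close> when \<open>z\<close> is close to \<open>zbar\<close>, that
  \<open>v z = (z - p z) / lam\<close> is a subgradient of the convex model at \<open>p z\<close>, and hence that the Moreau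
  envelope \<open>E\<close> is supported from below near \<open>zbar\<close> by its tangents of slope \<open>v z\<close>; from above it is
  always bounded by the tangent plus \<open>(norm (w - z))\<^sup>2 / (2 * lam)\<close>. Both bounds survive convex
  combinations, and the proximal average is \<open>phi x = (SUP w. E w - (norm (w - x))\<^sup>2 / (2 * lam))\<close> for the
  combined \<open>E\<close>. The two bounds identify the graph of the subdifferential of \<open>phi\<close> near
  \<open>(xbar, vbar)\<close> with the points \<open>(z - lam *\<^sub>R v z, v z)\<close>, and the supremum of the affine
  functions through these points is a convex model of \<open>phi\<close>.\<close>

section \<open>Subgradients of weakly convex functions\<close>

text \<open>Multiplying by the positive number \<open>norm (y - x)\<close> clears the quotient, and
  a lower limit is nonnegative exactly when the quotient is eventually at least \<open>-e\<close>
  for every \<open>e > 0\<close>. What remains is a first-order lower bound on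
  \<open>f\<close>.\<close>

lemma regular_subdiff_iff:
  fixes f :: "'a::real_inner \<Rightarrow> ereal"
  assumes fx: "f x = ereal a"
  shows "v \<in> regular_subdiff f x \<longleftrightarrow>
    (\<forall>e>0. \<forall>\<^sub>F y in at x. ereal (a + v \<bullet> (y - x) - e * norm (y - x)) \<le> f y)"
    (is "_ \<longleftrightarrow> ?R")
proof -
  let ?q = "\<lambda>y. (f y - f x - ereal (v \<bullet> (y - x))) / ereal (norm (y - x))"
  have q: "ereal (-e) \<le> ?q y \<longleftrightarrow> ereal (a + v \<bullet> (y - x) - e * norm (y - x)) \<le> f y"
    if "y \<noteq> x" for e y
  proof -
    have "norm (y - x) > 0" using that by simp
    then show ?thesis
      by (cases "f y") (simp_all add: fx pos_le_divide_eq algebra_simps)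
  qed
  have ev: "(\<forall>\<^sub>F y in at x. ereal (-e) \<le> ?q y) \<longleftrightarrow>
      (\<forall>\<^sub>F y in at x. ereal (a + v \<bullet> (y - x) - e * norm (y - x)) \<le> f y)" for e
    by (rule eventually_cong[OF _ q]) (auto simp: eventually_at_filter)
  have "v \<in> regular_subdiff f x \<longleftrightarrow> 0 \<le> Liminf (at x) ?q"
    by (simp add: regular_subdiff_def effdom_def fx)
  also have "\<dots> \<longleftrightarrow> (\<forall>e>0. \<forall>\<^sub>F y in at x. ereal (-e) \<le> ?q y)"
  proof
    assume "0 \<le> Liminf (at x) ?q"
    then have "\<forall>\<^sub>F y in at x. ereal (-e) < ?q y" if "e > 0" for e
      using that unfolding le_Liminf_iff by simp
    then show "\<forall>e>0. \<forall>\<^sub>F y in at x. ereal (-e) \<le> ?q y"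
      by (metis (mono_tags, lifting) eventually_mono less_imp_le)
  next
    assume R: "\<forall>e>0. \<forall>\<^sub>F y in at x. ereal (-e) \<le> ?q y"
    show "0 \<le> Liminf (at x) ?q"
      unfolding le_Liminf_iff
    proof (intro allI impI)
      fix c :: ereal assume "c < 0"
      then obtain b where "c < ereal b" "ereal b < 0" using ereal_dense2 by blast
      then have "\<forall>\<^sub>F y in at x. ereal b \<le> ?q y"
        using R[rule_format, of "-b"] by simp
      then show "\<forall>\<^sub>F y in at x. c < ?q y"
        by (rule eventually_mono) (use \<open>c < ereal b\<close> in auto)
    qed
  qed
  finally show ?thesis unfolding ev .
qed

text \<open>A quadratic error is of smaller order than \<open>norm (y - x)\<close>: the factor
  \<open>c * norm (y - x)\<close> drops below every \<open>e > 0\<close> near \<open>x\<close>. The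
  case \<open>c = 0\<close> covers affine minorants.\<close>

lemma regular_subdiffI_quadratic:
  fixes f :: "'a::real_inner \<Rightarrow> ereal"
  assumes fx: "f x = ereal a"
    and lower: "\<forall>\<^sub>F y in at x. ereal (a + v \<bullet> (y - x) - c * (norm (y - x))\<^sup>2) \<le> f y"
  shows "v \<in> regular_subdiff f x"
  unfolding regular_subdiff_iff[where f=f and x=x, OF fx]
proof (intro allI impI)
  fix e :: real assume "e > 0"
  have "((\<lambda>y. c * norm (y - x)) \<longlongrightarrow> c * norm (x - x)) (at x)"
    by (intro tendsto_intros)
  then have "\<forall>\<^sub>F y in at x. c * norm (y - x) < e"
    using \<open>e > 0\<close> by (intro order_tendstoD(2)[where y="c * norm (x - x)"]) auto
  with lower show "\<forall>\<^sub>F y in at x. ereal (a + v \<bullet> (y - x) - e * norm (y - x)) \<le> f y"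
  proof eventually_elim
    case (elim y)
    have "c * norm (y - x) * norm (y - x) \<le> e * norm (y - x)"
      using elim by (intro mult_right_mono) auto
    then have "ereal (a + v \<bullet> (y - x) - e * norm (y - x))
      \<le> ereal (a + v \<bullet> (y - x) - c * (norm (y - x))\<^sup>2)"
      by (simp add: power2_eq_square)
    with elim show ?case using order_trans by blast
  qed
qed

lemma regular_subset_limiting: "regular_subdiff f x \<subseteq> limiting_subdiff f x"
proof
  fix v assume v: "v \<in> regular_subdiff f x"
  then have "x \<in> effdom f" by (auto simp: regular_subdiff_def split: if_splits)
  with v show "v \<in> limiting_subdiff f x"
    by (simp add: limiting_subdiff_def) (rule exI[of _ "\<lambda>_. x"], auto)
qed

text \<open>Equivalent to convexity of \<open>f\<close> plus \<open>c\<close> times the squared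
  norm, since \<open>t * (1 - t) * (norm (y - x))\<^sup>2\<close> is the convexity gap of the
  squared norm. The real bounds \<open>a\<close> and \<open>b\<close> avoid arithmetic with infinite
  values.\<close>

definition weakly_convex :: "real \<Rightarrow> ('a::real_inner \<Rightarrow> ereal) \<Rightarrow> bool" where
  "weakly_convex c f \<longleftrightarrow> (\<forall>x y a b t. f x \<le> ereal a \<longrightarrow> f y \<le> ereal b \<longrightarrow> 0 < t \<longrightarrow> t < 1 \<longrightarrow>
     f (x + t *\<^sub>R (y - x)) \<le> ereal ((1 - t) * a + t * b + c * t * (1 - t) * (norm (y - x))\<^sup>2))"

lemma convex_fun_iff_weakly_convex: "convex_fun f \<longleftrightarrow> weakly_convex 0 f"
proof
  assume f: "convex_fun f"
  show "weakly_convex 0 f"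
    unfolding weakly_convex_def
  proof (intro allI impI)
    fix x y :: 'a and a b t :: real
    assume "f x \<le> ereal a" "f y \<le> ereal b" "0 < t" "t < 1"
    then have "(1 - t) *\<^sub>R (x, a) + t *\<^sub>R (y, b) \<in> {(x, t). f x \<le> ereal t}"
      using f unfolding convex_fun_def by (intro convexD) auto
    moreover have "x + t *\<^sub>R (y - x) = (1 - t) *\<^sub>R x + t *\<^sub>R y"
      by (simp add: algebra_simps)
    ultimately show "f (x + t *\<^sub>R (y - x))
        \<le> ereal ((1 - t) * a + t * b + 0 * t * (1 - t) * (norm (y - x))\<^sup>2)"
      by simp
  qed
next
  assume f: "weakly_convex 0 f"
  show "convex_fun f"
    unfolding convex_fun_def convex_alt
  proof (clarsimp)
    fix x y :: 'a and a b t :: real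
    assume *: "f x \<le> ereal a" "f y \<le> ereal b" "0 \<le> t" "t \<le> 1"
    have eq: "x + t *\<^sub>R (y - x) = (1 - t) *\<^sub>R x + t *\<^sub>R y"
      by (simp add: algebra_simps)
    consider "t = 0" | "t = 1" | "0 < t" "t < 1" using * by linarith
    then show "f ((1 - t) *\<^sub>R x + t *\<^sub>R y) \<le> ereal ((1 - t) * a + t * b)"
    proof cases
      case 3
      then show ?thesis
        using f[unfolded weakly_convex_def, rule_format, of x a y b t] * eq by simp
    qed (use * in auto)
  qed
qed

text \<open>At \<open>x + t *\<^sub>R d\<close> the local first-order bound lies below the chord
  bound of weak convexity. The contributions of \<open>a\<close> cancel and division by
  \<open>t\<close> turns the local inequality into a global one, at the price of the quadratic
  term.\<close>

lemma weakly_convex_regular_subgradient: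
  fixes f :: "'a::real_inner \<Rightarrow> ereal"
  assumes f: "weakly_convex c f" and "0 \<le> c" and fx: "f x = ereal a"
    and v: "v \<in> regular_subdiff f x" and fy: "f y \<le> ereal b"
  shows "a + v \<bullet> (y - x) - c * (norm (y - x))\<^sup>2 \<le> b"
proof (cases "y = x")
  case True
  then show ?thesis using fx fy by simp
next
  case False
  define d where "d = y - x"
  have d: "norm d > 0" using False by (simp add: d_def)
  have "a + v \<bullet> d - c * (norm d)\<^sup>2 \<le> b + e" if "e > 0" for e
  proof -
    \<comment> \<open>Scaled so that the first-order error at \<open>x + t *\<^sub>R d\<close> is
      exactly \<open>t * e\<close>.\<close>
    define e' where "e' = e / norm d"
    have "e' > 0" using d that by (simp add: e'_def)
    with v obtain s where s: "s > 0"
      and near: "\<And>y. y \<noteq> x \<Longrightarrow> dist y x < s \<Longrightarrow>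
        ereal (a + v \<bullet> (y - x) - e' * norm (y - x)) \<le> f y"
      unfolding regular_subdiff_iff[where f=f and x=x, OF fx] eventually_at by blast
    \<comment> \<open>The second bound puts \<open>x + t *\<^sub>R d\<close> within \<open>s\<close>
      of \<open>x\<close>; the bound \<open>1/2\<close> keeps \<open>t < 1\<close>.\<close>
    define t where "t = min (1/2) (s / (2 * norm d))"
    have t: "0 < t" "t < 1" using s d by (auto simp: t_def)
    have "t * norm d \<le> s / (2 * norm d) * norm d"
      by (intro mult_right_mono) (auto simp: t_def)
    then have "t * norm d < s" using s d by simp
    then have "ereal (a + v \<bullet> (t *\<^sub>R d) - e' * norm (t *\<^sub>R d)) \<le> f (x + t *\<^sub>R d)"
      using near[of "x + t *\<^sub>R d"] t d by (simp add: dist_norm)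
    also have "\<dots> \<le> ereal ((1 - t) * a + t * b + c * t * (1 - t) * (norm d)\<^sup>2)"
      using f[unfolded weakly_convex_def, rule_format, of x a y b t] fx fy t by (simp add: d_def)
    finally have "t * (v \<bullet> d - e) \<le> t * (b - a + c * (1 - t) * (norm d)\<^sup>2)"
      using t d by (simp add: e'_def algebra_simps)
    then have "v \<bullet> d - e \<le> b - a + c * (1 - t) * (norm d)\<^sup>2"
      using t by simp
    moreover have "c * (1 - t) * (norm d)\<^sup>2 \<le> c * (norm d)\<^sup>2"
      using t \<open>0 \<le> c\<close> by (intro mult_right_mono mult_left_le) auto
    ultimately show ?thesis by simp
  qed
  then show ?thesis unfolding d_def by (rule field_le_epsilon)
qed

text \<open>The inequality for regular subgradients is continuous in point, value and slope, so it
  survives the limit. The values along the sequence converge to the real number \<open>a\<close> and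
  are therefore eventually finite.\<close>

lemma weakly_convex_limiting_subgradient:
  fixes f :: "'a::real_inner \<Rightarrow> ereal"
  assumes f: "weakly_convex c f" and "0 \<le> c" and fx: "f x = ereal a"
    and v: "v \<in> limiting_subdiff f x"
  shows "ereal (a + v \<bullet> (y - x) - c * (norm (y - x))\<^sup>2) \<le> f y"
proof -
  obtain xs vs where reg: "\<And>k. vs k \<in> regular_subdiff f (xs k)" and xs: "xs \<longlonglongrightarrow> x"
    and fxs: "(\<lambda>k. f (xs k)) \<longlonglongrightarrow> f x" and vs: "vs \<longlonglongrightarrow> v"
    using v by (auto simp: limiting_subdiff_def split: if_splits)
  define A where "A = (\<lambda>k. real_of_ereal (f (xs k)))"
  have A: "A \<longlonglongrightarrow> a"
    unfolding A_def using fxs fx by (intro lim_real_of_ereal) simp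
  have "\<forall>\<^sub>F k in sequentially. f (xs k) > ereal (a - 1)"
    "\<forall>\<^sub>F k in sequentially. f (xs k) < ereal (a + 1)"
    using fxs fx by (auto intro: order_tendstoD)
  then have fin: "\<forall>\<^sub>F k in sequentially. f (xs k) = ereal (A k)"
  proof eventually_elim
    case (elim k)
    then show ?case by (cases "f (xs k)") (auto simp: A_def)
  qed
  have "a + v \<bullet> (y - x) - c * (norm (y - x))\<^sup>2 \<le> b" if b: "f y \<le> ereal b" for b
  proof (rule tendsto_upperbound)
    show "(\<lambda>k. A k + vs k \<bullet> (y - xs k) - c * (norm (y - xs k))\<^sup>2)
        \<longlonglongrightarrow> a + v \<bullet> (y - x) - c * (norm (y - x))\<^sup>2"
      by (intro tendsto_intros A xs vs)
    show "\<forall>\<^sub>F k in sequentially. A k + vs k \<bullet> (y - xs k) - c * (norm (y - xs k))\<^sup>2 \<le> b"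
      using fin by eventually_elim (rule weakly_convex_regular_subgradient[OF f \<open>0 \<le> c\<close> _ reg b])
  qed auto
  then show ?thesis
    using ereal_le_real by force
qed

section \<open>Suprema of real-valued functions\<close>

lemma lsc_fun_SUP:
  fixes F :: "'i \<Rightarrow> 'a::topological_space \<Rightarrow> real"
  assumes "\<And>i. i \<in> I \<Longrightarrow> continuous_on UNIV (F i)"
  shows "lsc_fun (\<lambda>x. SUP i\<in>I. ereal (F i x))"
  unfolding lsc_fun_def le_Liminf_iff
proof (intro allI impI)
  fix x c assume "c < (SUP i\<in>I. ereal (F i x))"
  then obtain i where i: "i \<in> I" "c < ereal (F i x)" by (auto simp: less_SUP_iff)
  have "((\<lambda>x. ereal (F i x)) \<longlongrightarrow> ereal (F i x)) (at x)"
    using assms[OF i(1)] by (intro tendsto_ereal) (simp add: continuous_on_def)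
  then have "\<forall>\<^sub>F y in at x. c < ereal (F i y)"
    using i(2) by (rule order_tendstoD)
  then show "\<forall>\<^sub>F y in at x. c < (SUP i\<in>I. ereal (F i y))"
    by (rule eventually_mono) (use i(1) in \<open>auto intro: less_le_trans SUP_upper\<close>)
qed

lemma weakly_convex_SUP:
  fixes F :: "'i \<Rightarrow> 'a::real_inner \<Rightarrow> real"
  assumes "\<And>i x y t. i \<in> I \<Longrightarrow> 0 < t \<Longrightarrow> t < 1 \<Longrightarrow>
    F i (x + t *\<^sub>R (y - x)) \<le> (1 - t) * F i x + t * F i y + c * t * (1 - t) * (norm (y - x))\<^sup>2"
  shows "weakly_convex c (\<lambda>x. SUP i\<in>I. ereal (F i x))"
  unfolding weakly_convex_def SUP_le_iff
proof (intro allI impI ballI)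
  fix x y :: 'a and a b t :: real and i
  assume "\<forall>i\<in>I. ereal (F i x) \<le> ereal a" "\<forall>i\<in>I. ereal (F i y) \<le> ereal b" "0 < t" "t < 1" "i \<in> I"
  then have "(1 - t) * F i x \<le> (1 - t) * a" "t * F i y \<le> t * b"
    by auto
  then show "ereal (F i (x + t *\<^sub>R (y - x)))
      \<le> ereal ((1 - t) * a + t * b + c * t * (1 - t) * (norm (y - x))\<^sup>2)"
    using assms[OF \<open>i \<in> I\<close> \<open>0 < t\<close> \<open>t < 1\<close>, of x y] by simp
qed

section \<open>From a locally convex envelope to variational convexity\<close>

lemma norm_add_sq: "(norm (a + b))\<^sup>2 = (norm a)\<^sup>2 + 2 * (a \<bullet> b) + (norm (b::'a::real_inner))\<^sup>2"
  by (simp add: power2_norm_eq_inner inner_simps inner_commute)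

text \<open>\<open>E\<close> plays the role of a Moreau envelope near \<open>zbar\<close> and \<open>v\<close> that of its gradient: the first
  conjunct says that \<open>E - (norm _)\<^sup>2 / (2 * lam)\<close> is concave, the second that \<open>E\<close> is convex
  near \<open>zbar\<close>, each with its supergradient or subgradient read off from \<open>v\<close>.\<close>

definition envelope_gradient ::
  "real \<Rightarrow> 'a::real_inner \<Rightarrow> 'a \<Rightarrow> ('a \<Rightarrow> real) \<Rightarrow> ('a \<Rightarrow> 'a) \<Rightarrow> bool" where
  "envelope_gradient lam zbar vbar E v \<longleftrightarrow>
     (\<forall>z w. E w \<le> E z + v z \<bullet> (w - z) + (norm (w - z))\<^sup>2 / (2 * lam)) \<and>
     (\<exists>del>0. \<forall>z\<in>ball zbar del. \<forall>w\<in>ball zbar del. E z + v z \<bullet> (w - z) \<le> E w) \<and>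
     (\<exists>L\<ge>0. \<forall>z. norm (v z - vbar) \<le> L * norm (z - zbar))"

text \<open>For fixed \<open>lam\<close>, \<open>zbar\<close> and \<open>vbar\<close> each condition
  is preserved by convex combinations of pairs \<open>(E, v)\<close>: the weights sum to 1, so the
  common quadratic term is unchanged. The smaller of the two radii and the averaged constant
  serve.\<close>

lemma envelope_gradient_combination:
  assumes v: "envelope_gradient lam zbar vbar E v" and v': "envelope_gradient lam zbar vbar E' v'"
    and \<alpha>: "0 \<le> \<alpha>" "\<alpha> \<le> 1"
  shows "envelope_gradient lam zbar vbar (\<lambda>z. \<alpha> * E z + (1 - \<alpha>) * E' z)
    (\<lambda>z. \<alpha> *\<^sub>R v z + (1 - \<alpha>) *\<^sub>R v' z)"
proof -
  have mix: "\<alpha> * s + (1 - \<alpha>) * s' \<le> \<alpha> * t + (1 - \<alpha>) * t'" if "s \<le> t" "s' \<le> t'" for s s' t t' :: real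
    using that \<alpha> by (intro add_mono mult_left_mono) auto
  obtain d where d: "0 < d"
    and lower: "\<And>z w. z \<in> ball zbar d \<Longrightarrow> w \<in> ball zbar d \<Longrightarrow> E z + v z \<bullet> (w - z) \<le> E w"
    using v unfolding envelope_gradient_def by blast
  obtain d' where d': "0 < d'"
    and lower': "\<And>z w. z \<in> ball zbar d' \<Longrightarrow> w \<in> ball zbar d' \<Longrightarrow> E' z + v' z \<bullet> (w - z) \<le> E' w"
    using v' unfolding envelope_gradient_def by blast
  obtain L where L: "0 \<le> L" "\<And>z. norm (v z - vbar) \<le> L * norm (z - zbar)"
    using v unfolding envelope_gradient_def by blast
  obtain L' where L': "0 \<le> L'" "\<And>z. norm (v' z - vbar) \<le> L' * norm (z - zbar)"
    using v' unfolding envelope_gradient_def by blast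
  have upper: "\<alpha> * E w + (1 - \<alpha>) * E' w \<le> \<alpha> * E z + (1 - \<alpha>) * E' z
      + (\<alpha> *\<^sub>R v z + (1 - \<alpha>) *\<^sub>R v' z) \<bullet> (w - z) + (norm (w - z))\<^sup>2 / (2 * lam)" for z w
  proof -
    define Q where "Q = (norm (w - z))\<^sup>2 / (2 * lam)"
    have "E w \<le> E z + v z \<bullet> (w - z) + Q" "E' w \<le> E' z + v' z \<bullet> (w - z) + Q"
      using v v' unfolding envelope_gradient_def Q_def by blast+
    from mix[OF this] show ?thesis
      unfolding Q_def[symmetric] by (simp add: inner_add_left algebra_simps)
  qed
  have lip: "norm (\<alpha> *\<^sub>R v z + (1 - \<alpha>) *\<^sub>R v' z - vbar) \<le> (\<alpha> * L + (1 - \<alpha>) * L') * norm (z - zbar)" for z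
  proof -
    have eq: "\<alpha> *\<^sub>R v z + (1 - \<alpha>) *\<^sub>R v' z - vbar = \<alpha> *\<^sub>R (v z - vbar) + (1 - \<alpha>) *\<^sub>R (v' z - vbar)"
      by (simp add: algebra_simps)
    have "norm (\<alpha> *\<^sub>R v z + (1 - \<alpha>) *\<^sub>R v' z - vbar)
        \<le> \<alpha> * norm (v z - vbar) + (1 - \<alpha>) * norm (v' z - vbar)"
      unfolding eq
      using norm_triangle_ineq[of "\<alpha> *\<^sub>R (v z - vbar)" "(1 - \<alpha>) *\<^sub>R (v' z - vbar)"] \<alpha> by simp
    also have "\<dots> \<le> \<alpha> * (L * norm (z - zbar)) + (1 - \<alpha>) * (L' * norm (z - zbar))"
      by (intro mix L L')
    also have "\<dots> = (\<alpha> * L + (1 - \<alpha>) * L') * norm (z - zbar)"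
      by (simp add: distrib_right)
    finally show ?thesis .
  qed
  have lower: "\<alpha> * E z + (1 - \<alpha>) * E' z + (\<alpha> *\<^sub>R v z + (1 - \<alpha>) *\<^sub>R v' z) \<bullet> (w - z)
      \<le> \<alpha> * E w + (1 - \<alpha>) * E' w"
    if "z \<in> ball zbar (min d d')" "w \<in> ball zbar (min d d')" for z w
  proof -
    have "\<alpha> * (E z + v z \<bullet> (w - z)) + (1 - \<alpha>) * (E' z + v' z \<bullet> (w - z))
        \<le> \<alpha> * E w + (1 - \<alpha>) * E' w"
      using that by (intro mix lower lower') auto
    then show ?thesis
      by (simp add: inner_add_left algebra_simps)
  qed
  have "0 < min d d'" "0 \<le> \<alpha> * L + (1 - \<alpha>) * L'" using d d' L L' \<alpha> by auto
  then show ?thesis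
    unfolding envelope_gradient_def using upper lower lip by blast
qed

text \<open>Minty's parametrization: a graph point \<open>(x, w)\<close> is recovered from
  \<open>z = x + lam *\<^sub>R w\<close> as \<open>(X z, v z)\<close>. Within
  \<open>U \<times> V\<close> the graphs of both \<open>phi\<close> and its convex model consist of
  such pairs with \<open>z\<close> near \<open>zbar\<close>, and both functions take the value
  \<open>A z\<close> at \<open>X z\<close>.\<close>

lemma variationally_convex_SUP_envelope:
  fixes E :: "'a::euclidean_space \<Rightarrow> real" and v :: "'a \<Rightarrow> 'a"
  assumes lam: "0 < lam" and v: "envelope_gradient lam (xbar + lam *\<^sub>R vbar) vbar E v"
  shows "variationally_convex (\<lambda>x. SUP w. ereal (E w - (norm (w - x))\<^sup>2 / (2 * lam))) xbar vbar"
proof -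
  define zbar where "zbar = xbar + lam *\<^sub>R vbar"
  define phi where "phi = (\<lambda>x. SUP w. ereal (E w - (norm (w - x))\<^sup>2 / (2 * lam)))"
  define X where "X z = z - lam *\<^sub>R v z" for z
  define A where "A z = E z - lam / 2 * (norm (v z))\<^sup>2" for z
  have upper: "E w \<le> E z + v z \<bullet> (w - z) + (norm (w - z))\<^sup>2 / (2 * lam)" for z w
    using v unfolding envelope_gradient_def by blast
  obtain del where del: "0 < del"
    and lower: "\<And>z w. z \<in> ball zbar del \<Longrightarrow> w \<in> ball zbar del \<Longrightarrow> E z + v z \<bullet> (w - z) \<le> E w"
    using v unfolding envelope_gradient_def zbar_def by blast
  obtain L where L: "0 \<le> L" and lip: "\<And>z. norm (v z - vbar) \<le> L * norm (z - zbar)"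
    using v unfolding envelope_gradient_def zbar_def by blast

  \<comment> \<open>Values and affine minorants of \<open>phi\<close>\<close>
  have phi_ge: "ereal (E w - (norm (w - x))\<^sup>2 / (2 * lam)) \<le> phi x" for w x
    unfolding phi_def by (rule SUP_upper) simp
  \<comment> \<open>Expanding the square around \<open>z\<close> turns the upper bound on
    \<open>E\<close> into the bound \<open>A z\<close> for every term of the supremum; the term
    \<open>w = z\<close> attains it.\<close>
  have phi_X: "phi (X z) = ereal (A z)" for z
  proof (rule antisym)
    have "E w - (norm (w - X z))\<^sup>2 / (2 * lam) \<le> A z" for w
    proof -
      have eq: "w - X z = (w - z) + lam *\<^sub>R v z" by (simp add: X_def)
      have "(norm (w - X z))\<^sup>2 = (norm (w - z))\<^sup>2 + 2 * lam * (v z \<bullet> (w - z)) + lam\<^sup>2 * (norm (v z))\<^sup>2"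
        unfolding eq norm_add_sq by (simp add: power_mult_distrib inner_commute)
      then have "(norm (w - X z))\<^sup>2 / (2 * lam)
          = (norm (w - z))\<^sup>2 / (2 * lam) + v z \<bullet> (w - z) + lam / 2 * (norm (v z))\<^sup>2"
        using lam by (simp add: field_simps power2_eq_square)
      then show ?thesis using upper[of w z] by (simp add: A_def)
    qed
    then show "phi (X z) \<le> ereal (A z)"
      unfolding phi_def by (intro SUP_least) simp
    have "E z - (norm (z - X z))\<^sup>2 / (2 * lam) = A z"
      using lam by (simp add: X_def A_def power_mult_distrib power2_eq_square)
    then show "ereal (A z) \<le> phi (X z)"
      using phi_ge[of z "X z"] by simp
  qed
  \<comment> \<open>Test the supremum at \<open>w = x + lam *\<^sub>R v z\<close>: the quadratic terms cancel and leave an affine minorant.\<close>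
  have phi_lower: "ereal (A z + v z \<bullet> (x - X z)) \<le> phi x"
    if "z \<in> ball zbar del" "x + lam *\<^sub>R v z \<in> ball zbar del" for x z
  proof -
    have "E z + v z \<bullet> (x + lam *\<^sub>R v z - z) \<le> E (x + lam *\<^sub>R v z)"
      by (rule lower[OF that])
    then have "A z + v z \<bullet> (x - X z) \<le> E (x + lam *\<^sub>R v z) - (norm (x + lam *\<^sub>R v z - x))\<^sup>2 / (2 * lam)"
      using lam by (simp add: A_def X_def inner_simps power_mult_distrib power2_eq_square dot_square_norm
          algebra_simps)
    then show ?thesis using phi_ge[of "x + lam *\<^sub>R v z" x] order_trans ereal_less_eq(3) by blast
  qed

  have v_zbar: "v zbar = vbar" using lip[of zbar] by simp
  have X_zbar: "X zbar = xbar" using v_zbar by (simp add: X_def zbar_def)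

  \<comment> \<open>The constant \<open>c\<close> gives \<open>del' * c = del / 2\<close>, the
    budget spent in \<open>X_shift\<close>. The three bounds in \<open>rho\<close> serve, in order,
    the level estimate \<open>phi_level\<close>, the inclusion \<open>U_shift\<close> and the
    inclusion \<open>UV\<close>.\<close>
  define c where "c = 1 + 2 * lam * L"
  define del' where "del' = del / (2 * c)"
  define rho where "rho = min 1 (min (del / 2) (del' / (1 + lam)))"
  have pos: "0 < c" using lam L by (simp add: c_def add_pos_nonneg)
  have del': "0 < del'" using del pos by (simp add: del'_def)
  have del'_eq: "del' + 2 * lam * L * del' = del / 2"
  proof -
    have "del' * c = del / 2" using pos by (simp add: del'_def)
    then show ?thesis by (simp add: c_def algebra_simps)
  qed
  have "lam * L * del' \<ge> 0" using lam L del' by simp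
  with del'_eq have del'_le: "del' < del" "lam * L * del' < del / 2" using del del' by linarith+
  have rho: "0 < rho" "rho \<le> 1" "rho \<le> del / 2" "rho * (1 + lam) \<le> del'"
  proof -
    show "0 < rho" "rho \<le> 1" using del del' lam by (auto simp: rho_def)
    show "rho \<le> del / 2"
      unfolding rho_def by (meson min.cobounded1 min.cobounded2 order_trans)
    have "rho \<le> del' / (1 + lam)" by (simp add: rho_def)
    then show "rho * (1 + lam) \<le> del'" using lam by (simp add: pos_le_divide_eq)
  qed
  define U where "U = ball xbar rho"
  define V where "V = ball vbar rho"
  define Z where "Z = ball zbar del'"
  have Z_sub: "z \<in> ball zbar del" if "z \<in> Z" for z
    using that del'_le by (auto simp: Z_def)
  have zbar_Z: "zbar \<in> Z" using del' by (simp add: Z_def)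
  have v_Z: "lam * norm (v z - vbar) \<le> lam * L * del'" if "z \<in> Z" for z
  proof -
    have "norm (v z - vbar) \<le> L * norm (z - zbar)" by (rule lip)
    also have "\<dots> \<le> L * del'"
      using that L by (intro mult_left_mono) (auto simp: Z_def dist_norm norm_minus_commute)
    finally show ?thesis using lam by simp
  qed
  have shift: "norm (x + lam *\<^sub>R w - zbar) \<le> norm (x - xbar) + lam * norm (w - vbar)" for x w
  proof -
    have eq: "x + lam *\<^sub>R w - zbar = (x - xbar) + lam *\<^sub>R (w - vbar)"
      by (simp add: zbar_def algebra_simps)
    show ?thesis unfolding eq using norm_triangle_ineq[of "x - xbar" "lam *\<^sub>R (w - vbar)"] lam by simp
  qed
  have UV: "x + lam *\<^sub>R w \<in> Z" if "x \<in> U" "w \<in> V" for x w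
  proof -
    have "norm (x - xbar) < rho" "norm (w - vbar) < rho"
      using that by (auto simp: U_def V_def dist_norm norm_minus_commute)
    then have "norm (x - xbar) + lam * norm (w - vbar) < rho + lam * rho"
      using lam by (intro add_strict_mono) auto
    then show ?thesis
      using shift[of x w] rho(4) by (simp add: Z_def dist_norm norm_minus_commute algebra_simps)
  qed
  have U_shift: "x + lam *\<^sub>R v z \<in> ball zbar del" if "x \<in> U" "z \<in> Z" for x z
    using that shift[of x "v z"] v_Z[of z] rho(3) del'_le(2)
    by (simp add: U_def dist_norm norm_minus_commute)
  \<comment> \<open>For \<open>z\<close> in \<open>Z\<close> the point \<open>X z\<close> may lie
    outside \<open>U\<close>, so \<open>U_shift\<close> is not enough to bound the affine pieces at
    \<open>X z\<close>.\<close>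
  have X_shift: "X z + lam *\<^sub>R v w \<in> ball zbar del" if "z \<in> Z" "w \<in> Z" for z w
  proof -
    have "X z - xbar = (z - zbar) - lam *\<^sub>R (v z - vbar)"
      by (simp add: X_def zbar_def algebra_simps)
    then have "norm (X z - xbar) \<le> norm (z - zbar) + lam * norm (v z - vbar)"
      using norm_triangle_ineq4[of "z - zbar" "lam *\<^sub>R (v z - vbar)"] lam by simp
    also have "\<dots> < del' + lam * L * del'"
      using that v_Z[of z] by (intro add_less_le_mono) (auto simp: Z_def dist_norm norm_minus_commute)
    finally have "norm (X z - xbar) + lam * norm (v w - vbar) < del / 2 "
      using v_Z[OF that(2)] del'_eq by linarith
    then show ?thesis
      using shift[of "X z" "v w"] del by (simp add: dist_norm norm_minus_commute)
  qed
  have phi_lower_U: "ereal (A z + v z \<bullet> (x - X z)) \<le> phi x" if "x \<in> U" "z \<in> Z" for x z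
    using that by (intro phi_lower Z_sub U_shift)

  \<comment> \<open>The convex model \<open>h\<close>\<close>
  define h where "h = (\<lambda>x. SUP z\<in>Z. ereal (A z + v z \<bullet> (x - X z)))"
  have h_ge: "ereal (A z + v z \<bullet> (x - X z)) \<le> h x" if "z \<in> Z" for x z
    unfolding h_def using that by (rule SUP_upper)
  have h_le: "h x \<le> phi x" if "x \<in> U" for x
    unfolding h_def using phi_lower_U[OF that] by (intro SUP_least)
  \<comment> \<open>At \<open>X z\<close> every affine piece indexed by \<open>Z\<close> stays below
    \<open>phi (X z)\<close>, which is \<open>A z\<close>, and the piece of \<open>z\<close> itself
    reaches it.\<close>
  have h_X: "h (X z) = ereal (A z)" if "z \<in> Z" for z
  proof (rule antisym)
    show "h (X z) \<le> ereal (A z)"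
      unfolding h_def
      using phi_lower[OF Z_sub X_shift[OF that]] by (intro SUP_least) (simp add: phi_X)
    show "ereal (A z) \<le> h (X z)" using h_ge[OF that, of "X z"] by simp
  qed
  have h_convex: "weakly_convex 0 h"
    unfolding h_def by (rule weakly_convex_SUP) (simp add: inner_simps algebra_simps)
  have h_lsc: "lsc_fun h"
    unfolding h_def by (intro lsc_fun_SUP continuous_intros)

  have phi_convex: "weakly_convex (1 / (2 * lam)) phi"
    unfolding phi_def
  proof (rule weakly_convex_SUP)
    fix w x y :: 'a and t :: real
    \<comment> \<open>Each term of the supremum satisfies the weak convexity inequality with
      equality, because the squared norm has an exact convexity gap.\<close>
    have "w - (x + t *\<^sub>R (y - x)) = (1 - t) *\<^sub>R (w - x) + t *\<^sub>R (w - y)"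
      by (simp add: algebra_simps)
    then have "(norm (w - (x + t *\<^sub>R (y - x))))\<^sup>2
        = (1 - t) * (norm (w - x))\<^sup>2 + t * (norm (w - y))\<^sup>2 - t * (1 - t) * (norm (y - x))\<^sup>2"
      by (simp add: power2_norm_eq_inner inner_simps inner_commute algebra_simps)
    then have "(norm (w - (x + t *\<^sub>R (y - x))))\<^sup>2 / (2 * lam)
        = (1 - t) * ((norm (w - x))\<^sup>2 / (2 * lam)) + t * ((norm (w - y))\<^sup>2 / (2 * lam))
          - t * (1 - t) * (norm (y - x))\<^sup>2 / (2 * lam)"
      by (simp add: add_divide_distrib diff_divide_distrib)
    then show "E w - (norm (w - (x + t *\<^sub>R (y - x))))\<^sup>2 / (2 * lam)
       \<le> (1 - t) * (E w - (norm (w - x))\<^sup>2 / (2 * lam)) + t * (E w - (norm (w - y))\<^sup>2 / (2 * lam))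
          + 1 / (2 * lam) * t * (1 - t) * (norm (y - x))\<^sup>2"
      by (simp add: algebra_simps)
  qed
  have phi_lsc: "lsc_fun phi"
    unfolding phi_def using lam by (intro lsc_fun_SUP continuous_intros) auto
  have phi_gt: "phi x > -\<infinity>" for x
    using phi_ge[of undefined x] by (rule less_le_trans[rotated]) simp
  have phi_xbar: "phi xbar = ereal (A zbar)" using phi_X[of zbar] by (simp add: X_zbar)

  \<comment> \<open>The pairs \<open>(X z, v z)\<close> belong to the two graphs\<close>
  have phi_subdiff: "v z \<in> limiting_subdiff phi (X z)" if "z \<in> Z" "X z \<in> U" for z
  proof (rule subsetD[OF regular_subset_limiting])
    have "\<forall>\<^sub>F y in at (X z). y \<in> U"
      using that(2) by (intro topological_tendstoD[OF tendsto_ident_at]) (auto simp: U_def)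
    then have "\<forall>\<^sub>F y in at (X z). ereal (A z + v z \<bullet> (y - X z) - 0 * (norm (y - X z))\<^sup>2) \<le> phi y"
      by (rule eventually_mono) (use phi_lower_U that in simp)
    then show "v z \<in> regular_subdiff phi (X z)"
      by (rule regular_subdiffI_quadratic[where f=phi, OF phi_X])
  qed
  have h_subdiff: "v z \<in> limiting_subdiff h (X z)" if "z \<in> Z" for z
  proof (rule subsetD[OF regular_subset_limiting])
    have "\<forall>\<^sub>F y in at (X z). ereal (A z + v z \<bullet> (y - X z) - 0 * (norm (y - X z))\<^sup>2) \<le> h y"
      using h_ge[OF that] by simp
    then show "v z \<in> regular_subdiff h (X z)"
      by (rule regular_subdiffI_quadratic[where f=h, OF h_X[OF that]])
  qed

  \<comment> \<open>On the pairs in question \<open>norm (v z) \<le> norm vbar + 1\<close> and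
    \<open>norm (xbar - X z) \<le> 1\<close>, so the minorant at \<open>X z\<close>, evaluated at
    \<open>xbar\<close>, gives \<open>A z \<le> A zbar + norm vbar + 1\<close>. One more unit makes
    the level condition strict, hence automatic.\<close>
  define eps where "eps = norm vbar + 2"
  have eps: "0 < eps" by (simp add: eps_def add_nonneg_pos)
  have phi_level: "phi (X z) < phi xbar + ereal eps" if "z \<in> Z" "X z \<in> U" "v z \<in> V" for z
  proof -
    have "xbar \<in> U" using rho by (simp add: U_def)
    then have "A z + v z \<bullet> (xbar - X z) \<le> A zbar"
      using phi_lower_U[OF \<open>xbar \<in> U\<close> that(1)] phi_xbar by simp
    moreover have "\<bar>v z \<bullet> (xbar - X z)\<bar> \<le> norm (v z) * norm (xbar - X z)"
      by (rule Cauchy_Schwarz_ineq2)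
    moreover have "norm (v z) * norm (xbar - X z) \<le> (norm vbar + 1) * 1"
    proof (rule mult_mono)
      show "norm (v z) \<le> norm vbar + 1"
        using that(3) rho(2) norm_triangle_sub[of "v z" vbar]
        by (simp add: V_def dist_norm norm_minus_commute)
      show "norm (xbar - X z) \<le> 1" using that(2) rho(2) by (simp add: U_def dist_norm)
    qed auto
    ultimately show ?thesis by (simp add: phi_X phi_xbar eps_def)
  qed

  \<comment> \<open>The graphs contain no other pairs in \<open>U \<times> V\<close>\<close>
  have graph_phi: "\<exists>z\<in>Z. x = X z \<and> w = v z"
    if x: "x \<in> U" and w: "w \<in> V" "w \<in> limiting_subdiff phi x" for x w
  proof -
    define z where "z = x + lam *\<^sub>R w"
    have z: "z \<in> Z" unfolding z_def using x w by (intro UV)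
    have "phi x < \<infinity>" using w(2) by (auto simp: limiting_subdiff_def effdom_def split: if_splits)
    then obtain a where a: "phi x = ereal a" using phi_gt[of x] by (cases "phi x") auto
    have sub: "a + w \<bullet> (y - x) - 1 / (2 * lam) * (norm (y - x))\<^sup>2 \<le> b" if "phi y = ereal b" for y b
      using weakly_convex_limiting_subgradient[where f=phi, OF phi_convex _ a w(2), of y] that lam by simp
    \<comment> \<open>\<open>x\<close> is a proximal point of \<open>phi\<close> at \<open>z\<close>, so \<open>w\<close> is a supergradient of \<open>E\<close> at \<open>z\<close> up to
      second order; it must agree with the subgradient \<open>v z\<close>.\<close>
    have Ez: "E u \<le> E z + w \<bullet> (u - z) + (norm (u - z))\<^sup>2 / (2 * lam)" for u
    proof -
      \<comment> \<open>Testing the subgradient inequality at the single point \<open>X z\<close>,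
        where \<open>phi\<close> is known, already gives
        \<open>a + lam / 2 * (norm w)\<^sup>2 \<le> E z\<close>.\<close>
      have "a + w \<bullet> (X z - x) - 1 / (2 * lam) * (norm (X z - x))\<^sup>2 \<le> A z"
        by (rule sub[OF phi_X])
      moreover have Xx: "X z - x = lam *\<^sub>R (w - v z)" by (simp add: X_def z_def algebra_simps)
      moreover have "w \<bullet> (X z - x) = lam * (norm w)\<^sup>2 - lam * (w \<bullet> v z)"
        unfolding Xx by (simp add: inner_diff_right power2_norm_eq_inner right_diff_distrib)
      moreover have "1 / (2 * lam) * (norm (X z - x))\<^sup>2
          = lam / 2 * (norm w)\<^sup>2 - lam * (w \<bullet> v z) + lam / 2 * (norm (v z))\<^sup>2"
      proof -
        have "1 / (2 * lam) * (norm (X z - x))\<^sup>2 = lam / 2 * (norm (w - v z))\<^sup>2"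
          unfolding Xx using lam by (simp add: power_mult_distrib power2_eq_square)
        moreover have "(norm (w - v z))\<^sup>2 = (norm w)\<^sup>2 - 2 * (w \<bullet> v z) + (norm (v z))\<^sup>2"
          using norm_add_sq[of w "- v z"] by simp
        ultimately show ?thesis by (simp only:) (simp add: algebra_simps)
      qed
      ultimately have "a + lam / 2 * (norm w)\<^sup>2 \<le> E z"
        unfolding A_def by linarith
      moreover have "E u - (norm (u - x))\<^sup>2 / (2 * lam) \<le> a"
        using phi_ge[of u x] a by simp
      moreover have "(norm (u - x))\<^sup>2 / (2 * lam)
          = (norm (u - z))\<^sup>2 / (2 * lam) + w \<bullet> (u - z) + lam / 2 * (norm w)\<^sup>2"
      proof -
        have eq: "u - x = (u - z) + lam *\<^sub>R w" by (simp add: z_def)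
        have "(norm (u - x))\<^sup>2 = (norm (u - z))\<^sup>2 + 2 * lam * (w \<bullet> (u - z)) + lam\<^sup>2 * (norm w)\<^sup>2"
          unfolding eq norm_add_sq by (simp add: power_mult_distrib inner_commute)
        then show ?thesis using lam by (simp add: field_simps power2_eq_square)
      qed
      ultimately show ?thesis by linarith
    qed
    have "v z = w"
    proof (rule ccontr)
      assume "v z \<noteq> w"
      define d where "d = v z - w"
      have d: "norm d > 0" using \<open>v z \<noteq> w\<close> by (simp add: d_def)
      \<comment> \<open>The second bound keeps \<open>z + s *\<^sub>R d\<close> in the ball where
        \<open>lower\<close> holds; \<open>s \<le> lam\<close> makes the quadratic error at most
        half of the first-order gain \<open>s * (norm d)\<^sup>2\<close>.\<close>
      define s where "s = min lam ((del - norm (z - zbar)) / (2 * norm d))"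
      have nz: "norm (z - zbar) < del" using Z_sub[OF z] by (simp add: dist_norm norm_minus_commute)
      have s: "0 < s" "s \<le> lam" using lam d nz by (auto simp: s_def)
      have "s * norm d \<le> (del - norm (z - zbar)) / (2 * norm d) * norm d"
        using d by (intro mult_right_mono) (auto simp: s_def)
      also have "\<dots> < del - norm (z - zbar)" using d nz by simp
      finally have "norm (z - zbar) + norm (s *\<^sub>R d) < del" using s by simp
      then have "norm (z - zbar + s *\<^sub>R d) < del"
        using norm_triangle_ineq[of "z - zbar" "s *\<^sub>R d"] by linarith
      then have "z + s *\<^sub>R d \<in> ball zbar del"
        by (simp add: mem_ball dist_norm norm_minus_commute[of zbar] algebra_simps)
      from lower[OF Z_sub[OF z] this] Ez[of "z + s *\<^sub>R d"]
      have "s * (v z \<bullet> d) \<le> s * (w \<bullet> d) + (norm (s *\<^sub>R d))\<^sup>2 / (2 * lam)"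
        by simp
      moreover have "s * (v z \<bullet> d) - s * (w \<bullet> d) = s * (norm d)\<^sup>2"
        unfolding power2_norm_eq_inner by (simp add: d_def inner_diff_left right_diff_distrib)
      moreover have "(norm (s *\<^sub>R d))\<^sup>2 / (2 * lam) = s * (s * (norm d)\<^sup>2 / (2 * lam))"
        by (simp add: power_mult_distrib power2_eq_square)
      ultimately have "s * (norm d)\<^sup>2 \<le> s * (s * (norm d)\<^sup>2 / (2 * lam))"
        by linarith
      then have "(norm d)\<^sup>2 \<le> s * (norm d)\<^sup>2 / (2 * lam)"
        using s by (simp only: mult_le_cancel_left_pos)
      also have "\<dots> \<le> lam * (norm d)\<^sup>2 / (2 * lam)"
        using s lam by (intro divide_right_mono mult_right_mono) auto
      finally show False using d lam by simp
    qed
    moreover have "x = X z" using \<open>v z = w\<close> by (simp add: X_def z_def)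
    ultimately show ?thesis using z by blast
  qed

  \<comment> \<open>A monotonicity argument: along \<open>x + lam *\<^sub>R w = z\<close> two points of the graph must coincide.\<close>
  have graph_h: "\<exists>z\<in>Z. x = X z \<and> w = v z"
    if x: "x \<in> U" and w: "w \<in> V" "w \<in> limiting_subdiff h x" for x w
  proof -
    define z where "z = x + lam *\<^sub>R w"
    have z: "z \<in> Z" unfolding z_def using x w by (intro UV)
    have "h x < \<infinity>" using w(2) by (auto simp: limiting_subdiff_def effdom_def split: if_splits)
    moreover have "ereal (A z + v z \<bullet> (x - X z)) \<le> h x" by (rule h_ge[OF z])
    ultimately obtain a where a: "h x = ereal a" by (cases "h x") auto
    have "A z + v z \<bullet> (x - X z) \<le> a" using h_ge[OF z, of x] a by simp
    moreover have "a + w \<bullet> (X z - x) \<le> A z"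
      using weakly_convex_limiting_subgradient[where f=h, OF h_convex _ a w(2), of "X z"] h_X[OF z] by simp
    ultimately have "v z \<bullet> (x - X z) + w \<bullet> (X z - x) \<le> 0" by linarith
    moreover have "x - X z = lam *\<^sub>R (v z - w)" "X z - x = lam *\<^sub>R (w - v z)"
      by (simp_all add: X_def z_def algebra_simps)
    ultimately have "lam * (norm (v z - w))\<^sup>2 \<le> 0"
      by (simp add: power2_norm_eq_inner inner_simps algebra_simps inner_commute)
    then have "v z = w" using lam by (simp add: mult_le_0_iff)
    moreover have "x = X z" using \<open>v z = w\<close> by (simp add: X_def z_def)
    ultimately show ?thesis using z by blast
  qed

  have common: "{x \<in> U. phi x < phi xbar + ereal eps} \<times> V \<inter> subdiff_graph phi = U \<times> V \<inter> subdiff_graph h"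
  proof (intro equalityI subsetI)
    fix q assume "q \<in> {x \<in> U. phi x < phi xbar + ereal eps} \<times> V \<inter> subdiff_graph phi"
    then obtain x w where q: "q = (x, w)" and x: "x \<in> U" and w: "w \<in> V" "w \<in> limiting_subdiff phi x"
      by (auto simp: subdiff_graph_def)
    obtain z where "z \<in> Z" "x = X z" "w = v z" using graph_phi[OF x w] by blast
    then show "q \<in> U \<times> V \<inter> subdiff_graph h"
      using q x w(1) h_subdiff by (simp add: subdiff_graph_def)
  next
    fix q assume "q \<in> U \<times> V \<inter> subdiff_graph h"
    then obtain x w where q: "q = (x, w)" and x: "x \<in> U" and w: "w \<in> V" "w \<in> limiting_subdiff h x"
      by (auto simp: subdiff_graph_def)
    obtain z where "z \<in> Z" "x = X z" "w = v z" using graph_h[OF x w] by blast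
    then show "q \<in> {x \<in> U. phi x < phi xbar + ereal eps} \<times> V \<inter> subdiff_graph phi"
      using q x w(1) phi_subdiff phi_level by (simp add: subdiff_graph_def)
  qed
  have agree: "phi x = h x" if x: "x \<in> U" and w: "w \<in> V" "w \<in> limiting_subdiff h x" for x w
    using graph_h[OF x w] h_X phi_X by auto

  have proper: "proper_fun phi"
    unfolding proper_fun_def using phi_gt phi_xbar by (metis PInfty_neq_ereal(1))
  have "xbar \<in> effdom phi" by (simp add: effdom_def phi_xbar)
  moreover have "vbar \<in> limiting_subdiff phi xbar"
    using phi_subdiff[OF zbar_Z] rho by (simp add: X_zbar v_zbar U_def)
  moreover have "convex_fun h" using h_convex by (simp add: convex_fun_iff_weakly_convex)
  ultimately have "variationally_convex phi xbar vbar"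
    unfolding variationally_convex_def using proper phi_lsc h_lsc h_le eps common agree rho(1)
    by (intro conjI exI[of _ U] exI[of _ V] exI[of _ h] exI[of _ eps])
      (auto simp: U_def V_def subdiff_graph_def)
  then show ?thesis unfolding phi_def .
qed

section \<open>The Moreau envelope of a variationally convex function\<close>

text \<open>The minimizers form the intersection of all sets \<open>{x. G x \<le> G w}\<close>.
  Finitely many of them meet the compact sublevel set at the best of finitely many points, so the
  finite intersection property applies.\<close>

lemma closed_sublevels_attain_min:
  fixes G :: "'a::topological_space \<Rightarrow> 'b::linorder"
  assumes closed: "\<And>c. closed {x. G x \<le> c}" and compact: "compact {x. G x \<le> G x0}"
  shows "\<exists>p. \<forall>w. G p \<le> G w"
proof -
  have "{x. G x \<le> G x0} \<inter> (\<Inter>w\<in>UNIV. {x. G x \<le> G w}) \<noteq> {}"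
  proof (rule compact_imp_fip_image[OF compact closed])
    fix W :: "'a set" assume "finite W"
    then obtain p where "p \<in> insert x0 W" "\<And>w. w \<in> insert x0 W \<Longrightarrow> G p \<le> G w"
      using ex_min_if_finite[of "G ` insert x0 W"] by (force simp: not_less)
    then show "{x. G x \<le> G x0} \<inter> (\<Inter>w\<in>W. {x. G x \<le> G w}) \<noteq> {}" by blast
  qed
  then show ?thesis by blast
qed

lemma closed_sublevel_add_continuous:
  fixes f :: "'a::topological_space \<Rightarrow> ereal"
  assumes f: "lsc_fun f" and q: "continuous_on UNIV q"
  shows "closed {x. f x + ereal (q x) \<le> c}"
proof -
  have "open {x. c < f x + ereal (q x)}"
  proof (subst open_subopen, intro allI impI ballI)
    fix x assume "x \<in> {x. c < f x + ereal (q x)}"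
    then obtain m where m: "c < ereal m" "ereal m < f x + ereal (q x)"
      using ereal_dense2 by blast
    \<comment> \<open>Splitting the level \<open>m\<close> into \<open>s\<close> for
      \<open>f\<close> and \<open>q x\<close> for \<open>q\<close> lets both parts vary separately,
      also when \<open>f x\<close> is infinite.\<close>
    define s where "s = m - q x"
    have s: "ereal s < f x" "c < ereal (s + q x)"
      using m by (cases "f x"; simp add: s_def)+
    have "\<forall>\<^sub>F y in at x. ereal s < f y"
      using f s(1) unfolding lsc_fun_def by (metis less_LiminfD less_le_trans)
    then have "\<forall>\<^sub>F y in nhds x. ereal s < f y"
      using s(1) by (simp add: eventually_nhds_conv_at)
    moreover have "(q \<longlongrightarrow> q x) (nhds x)"
      using q by (simp add: continuous_on_def tendsto_at_iff_tendsto_nhds)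
    then have "((\<lambda>y. ereal (s + q y)) \<longlongrightarrow> ereal (s + q x)) (nhds x)"
      by (intro tendsto_intros)
    then have "\<forall>\<^sub>F y in nhds x. c < ereal (s + q y)"
      using s(2) by (rule order_tendstoD)
    ultimately have "\<forall>\<^sub>F y in nhds x. c < f y + ereal (q y)"
    proof eventually_elim
      case (elim y)
      have "ereal (s + q y) \<le> f y + ereal (q y)"
        using elim(1) by (cases "f y") auto
      with elim(2) show ?case by (rule less_le_trans)
    qed
    then show "\<exists>T. open T \<and> x \<in> T \<and> T \<subseteq> {x. c < f x + ereal (q x)}"
      unfolding eventually_nhds by auto
  qed
  moreover have "{x. f x + ereal (q x) \<le> c} = - {x. c < f x + ereal (q x)}" by auto
  ultimately show ?thesis by (simp add: closed_def)
qed

text \<open>Inside \<open>U\<close> the affine bound is already stronger. Outside, the distance to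
  \<open>xbar\<close> is at least some \<open>d > 0\<close>, so a large multiple of its square
  absorbs constants, linear terms and the global quadratic minorant given by
  prox-boundedness.\<close>

lemma prox_bounded_quadratic_minorant:
  fixes f :: "'a::euclidean_space \<Rightarrow> ereal"
  assumes f: "prox_bounded f" and fx: "f xbar = ereal a" and "open U" "xbar \<in> U"
    and local: "\<And>x. x \<in> U \<Longrightarrow> ereal (a + vbar \<bullet> (x - xbar)) \<le> f x"
  obtains r where "0 < r"
    "\<And>x. ereal (a + vbar \<bullet> (x - xbar) - r * (norm (x - xbar))\<^sup>2) \<le> f x"
proof -
  obtain lam x0 where lam: "0 < lam" and fin: "moreau_env lam f x0 > -\<infinity>"
    using f unfolding prox_bounded_def by blast
  from fin obtain m where m: "ereal m < moreau_env lam f x0"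
    using ereal_dense2 by blast
  have fm: "ereal (m - (norm (x - x0))\<^sup>2 / (2 * lam)) \<le> f x" for x
  proof -
    have "ereal m \<le> f x + ereal (1 / (2 * lam) * (norm (x - x0))\<^sup>2)"
      using m unfolding moreau_env_def by (meson INF_lower UNIV_I less_imp_le order_trans)
    then show ?thesis by (cases "f x") auto
  qed
  obtain d where d: "0 < d" "ball xbar d \<subseteq> U" using assms(3,4) open_contains_ball by blast
  \<comment> \<open>The summands of \<open>r\<close> absorb, in order, the constant
    \<open>C\<close>, the quadratic part of the global minorant after
    \<open>(norm (x - x0))\<^sup>2\<close> is doubled and split, and the linear term with slope
    \<open>vbar\<close>.\<close>
  define C where "C = \<bar>a - m + (norm (xbar - x0))\<^sup>2 / lam\<bar>"
  define r where "r = C / d\<^sup>2 + 1 / lam + norm vbar / d"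
  have r: "0 < r" unfolding r_def using d lam by (intro add_pos_nonneg add_nonneg_pos) (auto simp: C_def)
  have main: "ereal (a + vbar \<bullet> (x - xbar) - r * (norm (x - xbar))\<^sup>2) \<le> f x" for x
  proof (cases "x \<in> U")
    case True
    have "ereal (a + vbar \<bullet> (x - xbar) - r * (norm (x - xbar))\<^sup>2) \<le> ereal (a + vbar \<bullet> (x - xbar))"
      using r by simp
    then show ?thesis using local[OF True] order_trans by blast
  next
    case False
    define s where "s = norm (x - xbar)"
    have s: "d \<le> s" using False d(2) by (force simp: s_def dist_norm norm_minus_commute)
    have "norm (x - x0) \<le> s + norm (xbar - x0)"
      unfolding s_def using norm_triangle_ineq[of "x - xbar" "xbar - x0"] by simp
    then have "(norm (x - x0))\<^sup>2 \<le> (s + norm (xbar - x0))\<^sup>2" by (intro power_mono) auto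
    also have "\<dots> \<le> 2 * s\<^sup>2 + 2 * (norm (xbar - x0))\<^sup>2"
      using zero_le_power2[of "s - norm (xbar - x0)"] by (simp add: power2_sum power2_diff)
    finally have "(norm (x - x0))\<^sup>2 / (2 * lam) \<le> s\<^sup>2 / lam + (norm (xbar - x0))\<^sup>2 / lam"
      using lam by (simp add: field_simps)
    moreover have "vbar \<bullet> (x - xbar) \<le> norm vbar * s"
      unfolding s_def by (rule norm_cauchy_schwarz)
    moreover have "norm vbar * s \<le> norm vbar / d * s\<^sup>2"
    proof -
      have "norm vbar * s * d \<le> norm vbar * s * s" using s d by (intro mult_left_mono) auto
      then show ?thesis using d by (simp add: field_simps power2_eq_square)
    qed
    moreover have "C \<le> C / d\<^sup>2 * s\<^sup>2"
    proof -
      have "C * d\<^sup>2 \<le> C * s\<^sup>2" using s d by (intro mult_left_mono power_mono) (auto simp: C_def)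
      then show ?thesis using d by (simp add: field_simps)
    qed
    moreover have "a - m + (norm (xbar - x0))\<^sup>2 / lam \<le> C" by (simp add: C_def)
    moreover have "r * s\<^sup>2 = C / d\<^sup>2 * s\<^sup>2 + s\<^sup>2 / lam + norm vbar / d * s\<^sup>2"
      by (simp add: r_def algebra_simps)
    ultimately have "a + vbar \<bullet> (x - xbar) - r * s\<^sup>2 \<le> m - (norm (x - x0))\<^sup>2 / (2 * lam)"
      by linarith
    then have "ereal (a + vbar \<bullet> (x - xbar) - r * s\<^sup>2) \<le> ereal (m - (norm (x - x0))\<^sup>2 / (2 * lam))"
      by simp
    then show ?thesis using fm[of x] unfolding s_def by (rule order_trans)
  qed
  show ?thesis by (rule that[OF r main])
qed

text \<open>The condition \<open>4 * r * lam \<le> 1\<close> lets the minorant consume at most half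
  of the proximal term. The remaining half bounds the sublevel sets, so minimizers exist, and it
  keeps them close to \<open>xbar\<close> when \<open>z\<close> is close to
  \<open>zbar\<close>.\<close>

lemma moreau_env_prox:
  fixes f :: "'a::euclidean_space \<Rightarrow> ereal"
  assumes f: "lsc_fun f" and fx: "f xbar = ereal a" and lam: "0 < lam" "4 * r * lam \<le> 1"
    and quad: "\<And>x. ereal (a + vbar \<bullet> (x - xbar) - r * (norm (x - xbar))\<^sup>2) \<le> f x"
  obtains E p fp where
    "\<And>z. moreau_env lam f z = ereal (E z)"
    "\<And>z. f (p z) = ereal (fp z)"
    "\<And>z. E z = fp z + (norm (p z - z))\<^sup>2 / (2 * lam)"
    "\<And>z. norm (p z - xbar) \<le> 4 * norm (z - (xbar + lam *\<^sub>R vbar))"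
proof -
  define zbar where "zbar = xbar + lam *\<^sub>R vbar"
  define G where "G z w = f w + ereal (1 / (2 * lam) * (norm (w - z))\<^sup>2)" for z w
  define K where "K z = a + (norm (xbar - z))\<^sup>2 / (2 * lam)" for z
  have G_xbar: "G z xbar = ereal (K z)" for z by (simp add: G_def K_def fx)
  \<comment> \<open>Expanding the proximal term around \<open>xbar\<close> produces
    \<open>- (vbar \<bullet> u)\<close>, which cancels the slope of the minorant; this is what the
    choice of \<open>zbar\<close> achieves.\<close>
  have key: "ereal (K z + (norm (w - xbar))\<^sup>2 / (4 * lam) - norm (w - xbar) * norm (z - zbar) / lam) \<le> G z w"
    for z w
  proof -
    define u where "u = w - xbar"
    have eq: "w - z = u + (xbar - z)" by (simp add: u_def)
    have "(norm (w - z))\<^sup>2 = (norm u)\<^sup>2 + 2 * (u \<bullet> (xbar - z)) + (norm (xbar - z))\<^sup>2"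
      unfolding eq norm_add_sq ..
    also have "u \<bullet> (xbar - z) = - (u \<bullet> (z - zbar)) - lam * (vbar \<bullet> u)"
      by (simp add: zbar_def inner_simps inner_commute algebra_simps)
    finally have "1 / (2 * lam) * (norm (w - z))\<^sup>2
        = (norm u)\<^sup>2 / (2 * lam) - (u \<bullet> (z - zbar)) / lam - vbar \<bullet> u + (norm (xbar - z))\<^sup>2 / (2 * lam)"
      using lam by (simp add: field_simps)
    moreover have "(u \<bullet> (z - zbar)) / lam \<le> norm u * norm (z - zbar) / lam"
      using lam by (intro divide_right_mono norm_cauchy_schwarz) auto
    moreover have "r * (norm u)\<^sup>2 \<le> (norm u)\<^sup>2 / (4 * lam)"
      using mult_right_mono[OF lam(2), of "(norm u)\<^sup>2"] lam(1) by (simp add: field_simps)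
    moreover have "(norm u)\<^sup>2 / (2 * lam) = (norm u)\<^sup>2 / (4 * lam) + (norm u)\<^sup>2 / (4 * lam)" by simp
    ultimately have "K z + (norm u)\<^sup>2 / (4 * lam) - norm u * norm (z - zbar) / lam
        \<le> (a + vbar \<bullet> u - r * (norm u)\<^sup>2) + 1 / (2 * lam) * (norm (w - z))\<^sup>2"
      unfolding K_def by linarith
    then have "ereal (K z + (norm u)\<^sup>2 / (4 * lam) - norm u * norm (z - zbar) / lam)
        \<le> ereal (a + vbar \<bullet> u - r * (norm u)\<^sup>2) + ereal (1 / (2 * lam) * (norm (w - z))\<^sup>2)"
      by simp
    also have "\<dots> \<le> G z w"
      unfolding G_def u_def by (intro add_right_mono quad)
    finally show ?thesis by (simp add: u_def)
  qed
  have near: "norm (w - xbar) \<le> 4 * norm (z - zbar)" if "G z w \<le> G z xbar" for z w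
  proof -
    have "K z + (norm (w - xbar))\<^sup>2 / (4 * lam) - norm (w - xbar) * norm (z - zbar) / lam \<le> K z"
      using order_trans[OF key that] by (simp add: G_xbar)
    then have "norm (w - xbar) * norm (w - xbar) \<le> norm (w - xbar) * (4 * norm (z - zbar))"
      using lam(1) by (simp add: field_simps power2_eq_square)
    then show ?thesis by (cases "w = xbar") auto
  qed
  have "\<exists>p. \<forall>w. G z p \<le> G z w" for z
  proof (rule closed_sublevels_attain_min)
    show closed: "closed {x. G z x \<le> c}" for c
      unfolding G_def using f by (intro closed_sublevel_add_continuous continuous_intros)
    have "{x. G z x \<le> G z xbar} \<subseteq> cball xbar (4 * norm (z - zbar))"
      using near by (auto simp: dist_norm norm_minus_commute)
    then show "compact {x. G z x \<le> G z xbar}"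
      unfolding compact_eq_bounded_closed by (intro conjI closed bounded_subset[OF bounded_cball])
  qed
  then obtain p where p: "\<And>z w. G z (p z) \<le> G z w" by metis
  have env: "moreau_env lam f z = G z (p z)" for z
    unfolding moreau_env_def G_def[symmetric]
    by (intro antisym INF_lower INF_greatest p UNIV_I)
  define fp where "fp z = real_of_ereal (f (p z))" for z
  have fp: "f (p z) = ereal (fp z)" for z
  proof -
    have "G z (p z) \<le> ereal (K z)" using p[of z xbar] by (simp add: G_xbar)
    then show ?thesis using quad[of "p z"] unfolding fp_def G_def by (cases "f (p z)") auto
  qed
  show ?thesis
  proof (rule that[of "\<lambda>z. fp z + (norm (p z - z))\<^sup>2 / (2 * lam)" p fp])
    show "moreau_env lam f z = ereal (fp z + (norm (p z - z))\<^sup>2 / (2 * lam))" for z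
      by (simp add: env G_def fp)
    show "norm (p z - xbar) \<le> 4 * norm (z - (xbar + lam *\<^sub>R vbar))" for z
      using near[OF p] by (simp add: zbar_def)
  qed (simp_all add: fp)
qed

text \<open>With \<open>v z = (z - p z) / lam\<close>, minimality makes \<open>v z\<close> a
  subgradient of \<open>f\<close> at \<open>p z\<close>. For \<open>z\<close> near
  \<open>zbar\<close> the pair enters the region where the graphs of \<open>f\<close> and
  \<open>h\<close> agree, and the global subgradient inequality of the convex \<open>h\<close>
  bounds the envelope from below.\<close>

lemma moreau_env_variationally_convex:
  fixes f :: "'a::euclidean_space \<Rightarrow> ereal"
  assumes f: "prox_bounded f" and vc: "variationally_convex f xbar vbar"
  obtains lam0 where "0 < lam0" "ereal lam0 \<le> prox_threshold f"
    "\<And>lam. 0 < lam \<Longrightarrow> lam < lam0 \<Longrightarrow> \<exists>E v. (\<forall>z. moreau_env lam f z = ereal (E z)) \<and>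
      envelope_gradient lam (xbar + lam *\<^sub>R vbar) vbar E v"
proof -
  have proper: "proper_fun f" and lsc: "lsc_fun f" and dom: "xbar \<in> effdom f"
    and vbar: "vbar \<in> limiting_subdiff f xbar"
    using vc by (auto simp: variationally_convex_def)
  obtain U V h eps where eps: "0 < eps"
    and U: "open U" "xbar \<in> U" and V: "open V" "vbar \<in> V"
    and h: "convex_fun h" and hf': "\<forall>x\<in>U. h x \<le> f x"
    and graph: "({x \<in> U. f x < f xbar + ereal eps} \<times> V) \<inter> subdiff_graph f = (U \<times> V) \<inter> subdiff_graph h"
    and agree: "\<forall>(x, v) \<in> (U \<times> V) \<inter> subdiff_graph h. f x = h x"
    using vc unfolding variationally_convex_def by (elim conjE exE) (rule that; assumption)
  have hf: "h x \<le> f x" if "x \<in> U" for x using hf' that by blast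
  obtain a where a: "f xbar = ereal a"
    using proper dom by (cases "f xbar") (auto simp: proper_fun_def effdom_def)
  have wc: "weakly_convex 0 h" using h by (simp add: convex_fun_iff_weakly_convex)
  have h_sub: "ereal (b + v \<bullet> (y - x)) \<le> h y"
    if "x \<in> U" "v \<in> V" "f x = ereal b" "b < a + eps" "v \<in> limiting_subdiff f x" for x v b y
  proof -
    have "(x, v) \<in> ({x \<in> U. f x < f xbar + ereal eps} \<times> V) \<inter> subdiff_graph f"
      using that a by (simp add: subdiff_graph_def)
    then have g: "(x, v) \<in> (U \<times> V) \<inter> subdiff_graph h" by (simp only: graph)
    then have "h x = ereal b" using bspec[OF agree g] that(3) by simp
    then show ?thesis
      using weakly_convex_limiting_subgradient[where f=h, OF wc, of x b v y] g
      by (simp add: subdiff_graph_def)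
  qed
  have local: "ereal (a + vbar \<bullet> (x - xbar)) \<le> f x" if "x \<in> U" for x
  proof (rule order_trans)
    show "ereal (a + vbar \<bullet> (x - xbar)) \<le> h x"
      by (rule h_sub[OF U(2) V(2) a _ vbar]) (use eps in simp)
  qed (rule hf[OF that])
  obtain r where r: "0 < r"
    and quad: "\<And>x. ereal (a + vbar \<bullet> (x - xbar) - r * (norm (x - xbar))\<^sup>2) \<le> f x"
    using prox_bounded_quadratic_minorant[OF f a U local] by blast
  define lam0 where "lam0 = 1 / (4 * r)"
  have lam0: "0 < lam0" "4 * r * lam0 \<le> 1" using r by (auto simp: lam0_def)
  show ?thesis
  proof (rule that[of lam0])
    show "0 < lam0" by (rule lam0)
    obtain E where "\<And>z. moreau_env lam0 f z = ereal (E z)"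
      by (rule moreau_env_prox[where f=f, OF lsc a lam0 quad]) (rule that)
    then have "moreau_env lam0 f xbar > -\<infinity>" by simp
    then show "ereal lam0 \<le> prox_threshold f"
      unfolding prox_threshold_def using lam0(1) by (intro SUP_upper) blast
  next
    fix lam :: real assume lam: "0 < lam" "lam < lam0"
    define zbar where "zbar = xbar + lam *\<^sub>R vbar"
    have "4 * r * lam \<le> 4 * r * lam0" using lam r by simp
    then have "4 * r * lam \<le> 1" using lam0 by linarith
    note prox = moreau_env_prox[where f=f, OF lsc a lam(1) this quad, folded zbar_def]
    obtain E p fp where env: "\<And>z. moreau_env lam f z = ereal (E z)"
      and fp: "\<And>z. f (p z) = ereal (fp z)"
      and E: "\<And>z. E z = fp z + (norm (p z - z))\<^sup>2 / (2 * lam)"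
      and p_near: "\<And>z. norm (p z - xbar) \<le> 4 * norm (z - zbar)"
      by (rule prox) (rule that)
    define v where "v z = (1 / lam) *\<^sub>R (z - p z)" for z
    have p: "p z = z - lam *\<^sub>R v z" for z using lam by (simp add: v_def)
    have E_v: "E z = fp z + lam / 2 * (norm (v z))\<^sup>2" for z
      unfolding E p using lam by (simp add: power_mult_distrib power2_eq_square)
    have E_le: "ereal (E z) \<le> f x + ereal (1 / (2 * lam) * (norm (x - z))\<^sup>2)" for x z
      unfolding env[symmetric] moreau_env_def by (rule INF_lower) simp
    have square: "(norm (y + lam *\<^sub>R x))\<^sup>2 / (2 * lam)
        = (norm y)\<^sup>2 / (2 * lam) + x \<bullet> y + lam / 2 * (norm x)\<^sup>2" for x y :: 'a
      unfolding norm_add_sq using lam(1)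
      by (simp add: power_mult_distrib inner_commute field_simps power2_eq_square)
    have upper: "E w \<le> E z + v z \<bullet> (w - z) + (norm (w - z))\<^sup>2 / (2 * lam)" for z w
    proof -
      have "E w \<le> fp z + (norm (w - p z))\<^sup>2 / (2 * lam)"
        using E_le[of w "p z"] by (simp add: fp norm_minus_commute)
      moreover have eq: "w - p z = (w - z) + lam *\<^sub>R v z" by (simp add: p)
      ultimately show ?thesis using square[of "w - z" "v z"] E_v[of z] by simp
    qed
    have lip: "norm (v z - vbar) \<le> 5 / lam * norm (z - zbar)" for z
    proof -
      have "v z - vbar = (1 / lam) *\<^sub>R ((z - zbar) - (p z - xbar))"
        using lam(1) by (simp add: v_def zbar_def algebra_simps)
      then have "norm (v z - vbar) = norm ((z - zbar) - (p z - xbar)) / lam"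
        using lam(1) by simp
      also have "\<dots> \<le> (5 * norm (z - zbar)) / lam"
        using lam(1) p_near[of z] norm_triangle_ineq4[of "z - zbar" "p z - xbar"]
        by (intro divide_right_mono) linarith+
      finally show ?thesis by simp
    qed
    have id: "((\<lambda>z. z) \<longlongrightarrow> zbar) (nhds zbar)" by (simp add: filterlim_ident)
    have lim0: "((\<lambda>z. c * norm (z - zbar)) \<longlongrightarrow> 0) (nhds zbar)" for c
      using tendsto_mult[OF tendsto_const[of c] tendsto_norm[OF tendsto_diff[OF id tendsto_const[of zbar]]]] by simp
    have "((\<lambda>z. p z - xbar) \<longlongrightarrow> 0) (nhds zbar)"
      by (rule Lim_null_comparison[OF _ lim0[of 4]]) (simp add: p_near)
    then have lim_p: "(p \<longlongrightarrow> xbar) (nhds zbar)" by (simp add: LIM_zero_iff)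
    have "((\<lambda>z. v z - vbar) \<longlongrightarrow> 0) (nhds zbar)"
      by (rule Lim_null_comparison[OF _ lim0[of "5 / lam"]]) (simp only: lip eventually_True)
    then have lim_v: "(v \<longlongrightarrow> vbar) (nhds zbar)" by (simp add: LIM_zero_iff)
    \<comment> \<open>Lower semicontinuity alone does not keep \<open>f (p z)\<close> below the
      level \<open>a + eps\<close>. Comparing \<open>p z\<close> with the competitor
      \<open>xbar\<close> bounds \<open>fp z\<close> by this expression, whose limit is
      \<open>a\<close>.\<close>
    have "((\<lambda>z. a + (norm (xbar - z))\<^sup>2 / (2 * lam) - lam / 2 * (norm (v z))\<^sup>2)
        \<longlongrightarrow> a + (norm (xbar - zbar))\<^sup>2 / (2 * lam) - lam / 2 * (norm vbar)\<^sup>2) (nhds zbar)"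
      using lam(1) by (intro tendsto_intros lim_v id) auto
    also have "a + (norm (xbar - zbar))\<^sup>2 / (2 * lam) - lam / 2 * (norm vbar)\<^sup>2 = a"
      using lam(1) by (simp add: zbar_def power_mult_distrib power2_eq_square)
    finally have "\<forall>\<^sub>F z in nhds zbar. a + (norm (xbar - z))\<^sup>2 / (2 * lam) - lam / 2 * (norm (v z))\<^sup>2 < a + eps"
      by (rule order_tendstoD) (use eps in simp)
    then have "\<forall>\<^sub>F z in nhds zbar. p z \<in> U \<and> v z \<in> V \<and> fp z < a + eps"
      using topological_tendstoD[OF lim_p U] topological_tendstoD[OF lim_v V]
    proof eventually_elim
      case (elim z)
      have "E z \<le> a + (norm (xbar - z))\<^sup>2 / (2 * lam)"
        using E_le[of z xbar] by (simp add: a)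
      then show ?case using elim E_v[of z] by linarith
    qed
    then obtain del where del: "0 < del"
      and near: "\<And>z. dist z zbar < del \<Longrightarrow> p z \<in> U \<and> v z \<in> V \<and> fp z < a + eps"
      unfolding eventually_nhds_metric by blast
    have subdiff: "v z \<in> limiting_subdiff f (p z)" for z
    proof (rule subsetD[OF regular_subset_limiting])
      have "ereal (fp z + v z \<bullet> (y - p z) - 1 / (2 * lam) * (norm (y - p z))\<^sup>2) \<le> f y" for y
      proof -
        have eq: "y - z = (y - p z) + lam *\<^sub>R (- v z)" by (simp add: p)
        have "E z - 1 / (2 * lam) * (norm (y - z))\<^sup>2
            = fp z + v z \<bullet> (y - p z) - 1 / (2 * lam) * (norm (y - p z))\<^sup>2"
          using square[of "y - p z" "- v z", folded eq] E_v[of z] by simp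
        then show ?thesis using E_le[of z y] by (cases "f y") auto
      qed
      then show "v z \<in> regular_subdiff f (p z)"
        by (intro regular_subdiffI_quadratic[where f=f, OF fp] always_eventually allI)
    qed
    have lower: "E z + v z \<bullet> (w - z) \<le> E w" if "z \<in> ball zbar del" "w \<in> ball zbar del" for z w
    proof -
      have z: "p z \<in> U" "v z \<in> V" "fp z < a + eps" and w: "p w \<in> U"
        using near[of z] near[of w] that by (auto simp: dist_commute)
      have "ereal (fp z + v z \<bullet> (p w - p z)) \<le> f (p w)"
        using h_sub[OF z(1,2) fp z(3) subdiff, of "p w"] hf[OF w] by (rule order_trans)
      then have "fp z + v z \<bullet> (p w - p z) \<le> fp w" by (simp add: fp)
      moreover have "v z \<bullet> (p w - p z) = v z \<bullet> (w - z) - lam * (v z \<bullet> v w) + lam * (norm (v z))\<^sup>2"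
        by (simp add: p inner_simps power2_norm_eq_inner algebra_simps)
      \<comment> \<open>In terms of \<open>fp\<close> and \<open>v\<close>, the claim follows from
        the subgradient inequality between \<open>p z\<close> and \<open>p w\<close> with exactly
        this square to spare.\<close>
      moreover have "0 \<le> lam / 2 * (norm (v w - v z))\<^sup>2" using lam by simp
      moreover have "(norm (v w - v z))\<^sup>2 = (norm (v w))\<^sup>2 - 2 * (v z \<bullet> v w) + (norm (v z))\<^sup>2"
        using norm_add_sq[of "v w" "- v z"] by (simp add: inner_commute)
      ultimately show ?thesis
        unfolding E_v by (simp add: algebra_simps)
    qed
    have "0 \<le> 5 / lam" using lam by simp
    then have "envelope_gradient lam zbar vbar E v"
      unfolding envelope_gradient_def using upper lower lip del by blast
    with env show "\<exists>E v. (\<forall>z. moreau_env lam f z = ereal (E z)) \<and>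
        envelope_gradient lam (xbar + lam *\<^sub>R vbar) vbar E v"
      unfolding zbar_def by blast
  qed
qed

section \<open>The proximal average\<close>

text \<open>Finite inner envelopes make the combination real-valued, so the outer minus sign turns
  the infimum into the supremum treated above.\<close>

lemma prox_average_eq_SUP:
  assumes "\<And>z. moreau_env lam f z = ereal (Ef z)" "\<And>z. moreau_env lam g z = ereal (Eg z)"
  shows "prox_average lam \<alpha> f g =
    (\<lambda>x. SUP w. ereal (\<alpha> * Ef w + (1 - \<alpha>) * Eg w - (norm (w - x))\<^sup>2 / (2 * lam)))"
proof
  fix x
  have "moreau_env lam (\<lambda>w. - (ereal \<alpha> * moreau_env lam f w) - ereal (1 - \<alpha>) * moreau_env lam g w) x
      = (INF w. - ereal (\<alpha> * Ef w + (1 - \<alpha>) * Eg w - (norm (w - x))\<^sup>2 / (2 * lam)))"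
    unfolding moreau_env_def[of lam "\<lambda>w. - (ereal \<alpha> * moreau_env lam f w) - ereal (1 - \<alpha>) * moreau_env lam g w"]
    by (simp add: assms algebra_simps)
  then show "prox_average lam \<alpha> f g x =
      (SUP w. ereal (\<alpha> * Ef w + (1 - \<alpha>) * Eg w - (norm (w - x))\<^sup>2 / (2 * lam)))"
    unfolding prox_average_def by (simp only: ereal_INF_uminus_eq ereal_uminus_uminus)
qed

theorem theorem4p13:
  fixes f g :: "real ^ 'n \<Rightarrow> ereal" and xbar vbar :: "real ^ 'n"
  assumes "proper_fun f" and "lsc_fun f" and "prox_bounded f"
    and "proper_fun g" and "lsc_fun g" and "prox_bounded g"
    and "xbar \<in> effdom f \<inter> effdom g"
    and "vbar \<in> limiting_subdiff f xbar \<inter> limiting_subdiff g xbar"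
    and "variationally_convex f xbar vbar"
    and "variationally_convex g xbar vbar"
  shows "\<exists>lam\<^sub>0>0. ereal lam\<^sub>0 \<le> min (prox_threshold f) (prox_threshold g) \<and>
           (\<forall>lam \<alpha>. 0 < lam \<and> lam < lam\<^sub>0 \<and> 0 \<le> \<alpha> \<and> \<alpha> \<le> 1 \<longrightarrow>
              variationally_convex (prox_average lam \<alpha> f g) xbar vbar)"
proof -
  obtain lf where lf: "0 < lf" "ereal lf \<le> prox_threshold f"
    and envf: "\<And>lam. 0 < lam \<Longrightarrow> lam < lf \<Longrightarrow> \<exists>E v. (\<forall>z. moreau_env lam f z = ereal (E z)) \<and>
      envelope_gradient lam (xbar + lam *\<^sub>R vbar) vbar E v"
    using moreau_env_variationally_convex[OF assms(3,9)] by blast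
  obtain lg where lg: "0 < lg" "ereal lg \<le> prox_threshold g"
    and envg: "\<And>lam. 0 < lam \<Longrightarrow> lam < lg \<Longrightarrow> \<exists>E v. (\<forall>z. moreau_env lam g z = ereal (E z)) \<and>
      envelope_gradient lam (xbar + lam *\<^sub>R vbar) vbar E v"
    using moreau_env_variationally_convex[OF assms(6,10)] by blast
  \<comment> \<open>The bound \<open>min lf lg\<close> comes from the two envelopes before
    \<open>\<alpha>\<close> is chosen, so it is uniform in \<open>\<alpha>\<close>.\<close>
  have "variationally_convex (prox_average lam \<alpha> f g) xbar vbar"
    if lam: "0 < lam" "lam < min lf lg" and \<alpha>: "0 \<le> \<alpha>" "\<alpha> \<le> 1" for lam \<alpha>
  proof -
    obtain E v where E: "\<And>z. moreau_env lam f z = ereal (E z)"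
      and v: "envelope_gradient lam (xbar + lam *\<^sub>R vbar) vbar E v"
      using envf[of lam] lam by auto
    obtain E' v' where E': "\<And>z. moreau_env lam g z = ereal (E' z)"
      and v': "envelope_gradient lam (xbar + lam *\<^sub>R vbar) vbar E' v'"
      using envg[of lam] lam by auto
    show ?thesis
      unfolding prox_average_eq_SUP[OF E E']
      by (rule variationally_convex_SUP_envelope[OF lam(1) envelope_gradient_combination[OF v v' \<alpha>]])
  qed
  moreover have "ereal (min lf lg) \<le> min (prox_threshold f) (prox_threshold g)"
  proof (rule min.boundedI)
    show "ereal (min lf lg) \<le> prox_threshold f" using lf(2) by (rule order_trans[rotated]) simp
    show "ereal (min lf lg) \<le> prox_threshold g" using lg(2) by (rule order_trans[rotated]) simp
  qed
  ultimately show ?thesis using lf lg by (intro exI[of _ "min lf lg"]) auto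
qed

end
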